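(* There exists a connected, simple, diamond-free, claw-free cubic graph $H$ on $18$ vertices that is not the triangular prism $C_3\,\square\,K_2$ and satisfies $\chi'_s(H)=7$.
   Context: A cubic graph is a graph all of whose vertices have degree $3$. A graph is claw-free if it contains no induced $K_{1,3}$. A graph is diamond-free if it contains no $K_4-e$ ($K_4$ minus an edge) as a (not necessarily induced) subgraph; equivalently, no edge lies in two triangles. The triangular prism is $C_3\,\square\,K_2$. A strong edge coloring of a simple graph $G$ assigns colors to the edges of $G$ so that any two distinct edges that are either adjacent (share an endpoint) or joined by an edge of $G$ (some endpoint of one is adjacent in $G$ to some endpoint of the other) receive distinct colors. The strong chromatic index $\chi'_s(G)$ is the minimum number of colors in a strong edge coloring of $G$; equivalently, $\chi'_s(G)=\chi(L(G)^2)$, the chromatic number of the square of the line graph of $G$. *)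

theory Defs
  imports "Graph_Theory.Kuratowski" "Graph_Theory.Digraph_Isomorphism"
begin

text \<open>
  A finite simple graph is an instance of \<^locale>\<open>pair_graph\<close>: a finite, loop-free, symmetric
  relation on its vertex set. An undirected edge \<open>uv\<close> is thus represented by the two arcs
  \<open>(u,v)\<close> and \<open>(v,u)\<close>; as an object to be coloured it is the doubleton \<open>{u,v}\<close>.
\<close>

definition edges :: "'a pair_pre_digraph \<Rightarrow> 'a set set" where
  "edges G = {{u, v} | u v. (u, v) \<in> parcs G}"

text \<open>In a symmetric digraph every undirected edge at \<open>v\<close> contributes exactly one arc leaving \<open>v\<close>.\<close>

definition cubic :: "'a pair_pre_digraph \<Rightarrow> bool" where
  "cubic G \<longleftrightarrow> (\<forall>v \<in> pverts G. out_degree (with_proj G) v = 3)"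

definition claw_free :: "'a pair_pre_digraph \<Rightarrow> bool" where
  "claw_free G \<longleftrightarrow>
     \<not> (\<exists>K. induced_subgraph (with_proj K) (with_proj G) \<and>
          complete_bipartite_digraph 1 3 (with_proj K))"

definition is_diamond :: "'a pair_pre_digraph \<Rightarrow> bool" where
  "is_diamond D \<longleftrightarrow>
     (\<exists>(K :: 'a pair_pre_digraph) u v. complete_digraph 4 (with_proj K) \<and> (u, v) \<in> parcs K \<and>
        D = \<lparr> pverts = pverts K, parcs = parcs K - {(u, v), (v, u)} \<rparr>)"

definition diamond_free :: "'a pair_pre_digraph \<Rightarrow> bool" where
  "diamond_free G \<longleftrightarrow> \<not> (\<exists>D :: 'a pair_pre_digraph. subgraph (with_proj D) (with_proj G) \<and> is_diamond D)"

definition cycle_graph :: "nat \<Rightarrow> nat pair_pre_digraph" where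
  "cycle_graph n =
     \<lparr> pverts = {..<n}, parcs = (\<Union>i<n. {(i, Suc i mod n), (Suc i mod n, i)}) \<rparr>"

definition complete_graph :: "nat \<Rightarrow> nat pair_pre_digraph" where
  "complete_graph n = \<lparr> pverts = {..<n}, parcs = {(i, j). i < n \<and> j < n \<and> i \<noteq> j} \<rparr>"

definition cartesian_product ::
    "'a pair_pre_digraph \<Rightarrow> 'b pair_pre_digraph \<Rightarrow> ('a \<times> 'b) pair_pre_digraph" where
  "cartesian_product G H =
     \<lparr> pverts = pverts G \<times> pverts H,
       parcs = {((u, x), (v, y)) | u x v y.
                  (u = v \<and> u \<in> pverts G \<and> (x, y) \<in> parcs H) \<or>
                  (x = y \<and> x \<in> pverts H \<and> (u, v) \<in> parcs G)} \<rparr>"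

definition triangular_prism :: "(nat \<times> nat) pair_pre_digraph" where
  "triangular_prism = cartesian_product (cycle_graph 3) (complete_graph 2)"

definition strong_edge_coloring :: "'a pair_pre_digraph \<Rightarrow> ('a set \<Rightarrow> nat) \<Rightarrow> bool" where
  "strong_edge_coloring G c \<longleftrightarrow>
     (\<forall>e \<in> edges G. \<forall>f \<in> edges G.
        e \<noteq> f \<and> (e \<inter> f \<noteq> {} \<or> (\<exists>u \<in> e. \<exists>v \<in> f. (u, v) \<in> parcs G)) \<longrightarrow> c e \<noteq> c f)"

text \<open>Meaningful for finite \<open>G\<close>, where an injective colouring shows that the minimum exists.\<close>

definition strong_chromatic_index :: "'a pair_pre_digraph \<Rightarrow> nat" where
  "strong_chromatic_index G =
     (LEAST k. \<exists>c. strong_edge_coloring G c \<and> card (c ` edges G) = k)"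

end

theory Submission
  imports Defs
begin

text \<open>
  The graph is the truncation of a cubic multigraph on six vertices: each vertex is blown up to a
  triangle, which makes the result cubic, claw-free and diamond-free. In a strong edge coloring of
  such a graph with only six colours, the three edges of a triangle and the three edges leaving it
  conflict pairwise, so every triangle sees each colour exactly once. This rigidity is strong enough
  to rule out a specific piece of the graph, here called a block: a triangle \<open>x y z\<close> whose vertices
  \<open>y\<close> and \<open>z\<close> are linked to triangles \<open>p p\<^sub>1 p\<^sub>2\<close> and \<open>q q\<^sub>1 q\<^sub>2\<close>, which are linked to each other
  by \<open>p\<^sub>1 q\<^sub>1\<close> and \<open>p\<^sub>2 q\<^sub>2\<close>, while \<open>x\<close> has its third edge to the outside.

  Suppose a block has been coloured with six colours. The triangles at \<open>p\<close> and \<open>q\<close> share the colours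
  of the two links between them, so each triangle together with its remaining edge \<open>y p\<close> or \<open>z q\<close>
  carries the same four colours. A colour of \<open>p\<^sub>1 p\<^sub>2\<close> cannot occur on the triangle at \<open>q\<close>, because
  every edge of that triangle meets \<open>q\<^sub>1\<close> or \<open>q\<^sub>2\<close>. Hence \<open>p\<^sub>1 p\<^sub>2\<close> has the colour of \<open>z q\<close>, by
  symmetry \<open>q\<^sub>1 q\<^sub>2\<close> has the colour of \<open>y p\<close>, and the two edges of the triangle at \<open>p\<close>
  have the same two colours as the two edges of the triangle at \<open>q\<close>. These colours avoid everything
  at \<open>y\<close> and everything at \<open>z\<close>, and the only one of the six colours around \<open>x y z\<close> that
  does so is the colour of the edge leaving \<open>x\<close>: one colour for two edges
  (\<open>no_six_colour_pattern\<close>, \<open>seven_colours_if_block\<close>).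

  A block has nine vertices and a single vertex of degree two, so two copies joined by a bridge form
  a cubic graph on 18 vertices, and a seven-colouring can be given explicitly.
\<close>

section \<open>Recognising graph properties from local conditions\<close>

text \<open>
  In a cubic graph the leaves of a claw would be all neighbours of the centre, but two of them are
  adjacent as soon as the centre lies in a triangle.
\<close>

lemma (in pair_graph) claw_free_if_cubic_if_vertices_in_triangles:
  assumes "cubic G"
    and triangle: "\<And>v. v \<in> pverts G \<Longrightarrow> \<exists>a b. (v, a) \<in> parcs G \<and> (v, b) \<in> parcs G \<and> (a, b) \<in> parcs G"
  shows "claw_free G"
  unfolding claw_free_def
proof
  assume "\<exists>K. induced_subgraph (with_proj K) (with_proj G) \<and>
      complete_bipartite_digraph 1 3 (with_proj K)"
  then obtain K where induced: "induced_subgraph (with_proj K) (with_proj G)"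
    and "complete_bipartite_digraph 1 3 (with_proj K)" by blast
  then obtain U V where UV: "pverts K = U \<union> V" "U \<inter> V = {}" "card U = 1" "card V = 3"
      "parcs K = U \<times> V \<union> V \<times> U"
    unfolding complete_bipartite_digraph_pair_def by blast
  have "pverts K \<subseteq> pverts G"
    and parcs_K: "parcs K = {e \<in> parcs G. fst e \<in> pverts K \<and> snd e \<in> pverts K}"
    using induced unfolding induced_subgraph_def subgraph_def by simp_all
  from \<open>card U = 1\<close> obtain u where "U = {u}" by (auto simp: card_1_singleton_iff)
  have "u \<in> pverts G" using \<open>pverts K \<subseteq> pverts G\<close> UV(1) \<open>U = {u}\<close> by auto
  \<comment> \<open>The three leaves of a claw exhaust the neighbourhood of its centre.\<close>
  have neighbours: "{u} \<times> V = {e \<in> parcs G. fst e = u}"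
  proof (rule card_subset_eq)
    show "finite {e \<in> parcs G. fst e = u}" using pair_finite_arcs by simp
    show "{u} \<times> V \<subseteq> {e \<in> parcs G. fst e = u}"
    proof
      fix e assume "e \<in> {u} \<times> V"
      then have "e \<in> parcs K" unfolding UV(5) \<open>U = {u}\<close> by blast
      then show "e \<in> {e \<in> parcs G. fst e = u}" using \<open>e \<in> {u} \<times> V\<close> unfolding parcs_K by auto
    qed
    show "card ({u} \<times> V) = card {e \<in> parcs G. fst e = u}"
      using \<open>cubic G\<close> \<open>u \<in> pverts G\<close> \<open>card V = 3\<close>
      by (auto simp: cubic_def out_degree_def out_arcs_def card_cartesian_product_singleton)
  qed
  have leaf: "w \<in> V" if "(u, w) \<in> parcs G" for w
  proof -
    have "(u, w) \<in> {u} \<times> V" unfolding neighbours using that by simp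
    then show ?thesis by simp
  qed
  obtain a b where "(u, a) \<in> parcs G" "(u, b) \<in> parcs G" "(a, b) \<in> parcs G"
    using triangle[OF \<open>u \<in> pverts G\<close>] by blast
  with leaf have "a \<in> V" "b \<in> V" by simp_all
  then have "(a, b) \<in> parcs K" unfolding parcs_K UV(1) using \<open>(a, b) \<in> parcs G\<close> by simp
  then show False unfolding UV(5) using UV(2) \<open>a \<in> V\<close> \<open>b \<in> V\<close> by blast
qed

text \<open>
  In a diamond, the two non-adjacent vertices are both common neighbours of the other two, which are
  adjacent to each other.
\<close>

lemma diamond_free_if_unique_common_neighbour:
  assumes unique: "\<And>u v w w'. (w, w') \<in> parcs G \<Longrightarrow>
      {(w, u), (w', u), (w, v), (w', v)} \<subseteq> parcs G \<Longrightarrow> u = v"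
  shows "diamond_free G"
  unfolding diamond_free_def is_diamond_def
proof clarify
  fix D K :: "'a pair_pre_digraph" and u v
  assume sub: "subgraph (with_proj \<lparr>pverts = pverts K, parcs = parcs K - {(u, v), (v, u)}\<rparr>) (with_proj G)"
    and "complete_digraph 4 (with_proj K)" and "(u, v) \<in> parcs K"
  then have K: "finite (pverts K)" "card (pverts K) = 4"
      "parcs K = {(u,v). (u,v) \<in> (pverts K \<times> pverts K) \<and> u \<noteq> v}"
    unfolding complete_digraph_pair_def by auto
  with \<open>(u, v) \<in> parcs K\<close> have "u \<in> pverts K" "v \<in> pverts K" "u \<noteq> v" by auto
  with K have "card (pverts K - {u, v}) = 2" by (simp add: card_Diff_subset)
  then obtain w w' where "pverts K - {u, v} = {w, w'}" "w \<noteq> w'" by (auto simp: card_2_iff)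
  then have ww: "w \<in> pverts K" "w' \<in> pverts K" "w \<noteq> u" "w \<noteq> v" "w' \<noteq> u" "w' \<noteq> v" by auto
  from sub have "parcs K - {(u, v), (v, u)} \<subseteq> parcs G" by (simp add: subgraph_def)
  then have "(w, w') \<in> parcs G" "{(w, u), (w', u), (w, v), (w', v)} \<subseteq> parcs G"
    using K(3) ww \<open>w \<noteq> w'\<close> \<open>u \<in> pverts K\<close> \<open>v \<in> pverts K\<close> by auto
  with unique \<open>u \<noteq> v\<close> show False by metis
qed

text \<open>Descending along \<open>h\<close> leads from every vertex to the root \<open>r\<close>.\<close>

lemma (in pair_graph) connected_if_smaller_neighbours:
  assumes "r \<in> pverts G"
    and smaller: "\<And>v. v \<in> pverts G \<Longrightarrow> v \<noteq> r \<Longrightarrow> \<exists>u. (v, u) \<in> parcs G \<and> h u < (h v :: nat)"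
  shows "connected (with_proj G)"
proof -
  have to_root: "v \<rightarrow>\<^sup>*\<^bsub>with_proj G\<^esub> r" if "v \<in> pverts G" for v
    using that
  proof (induction v rule: measure_induct_rule[of h])
    case (less v)
    show ?case
    proof (cases "v = r")
      case False
      with smaller less.prems obtain u where u: "(v, u) \<in> parcs G" "h u < h v" by blast
      moreover from u have "u \<in> pverts G" by (simp add: in_arcsD2)
      ultimately show ?thesis using less.IH by (blast intro: adj_reachable_trans)
    qed (use \<open>r \<in> pverts G\<close> in simp)
  qed
  show ?thesis unfolding connected_def
  proof (rule strongly_connectedI)
    show "verts (with_proj (mk_symmetric (with_proj G))) \<noteq> {}"
      using assms(1) by (auto simp: mk_symmetric_def)
  next
    fix u v assume "u \<in> verts (with_proj (mk_symmetric (with_proj G)))"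
      "v \<in> verts (with_proj (mk_symmetric (with_proj G)))"
    then have "u \<rightarrow>\<^sup>*\<^bsub>with_proj G\<^esub> r" "v \<rightarrow>\<^sup>*\<^bsub>with_proj G\<^esub> r" using to_root by (auto simp: mk_symmetric_def)
    then have "u \<rightarrow>\<^sup>*\<^bsub>with_proj G\<^esub> v" using symmetric_reachable' reachable_trans by blast
    then show "u \<rightarrow>\<^sup>*\<^bsub>with_proj (mk_symmetric (with_proj G))\<^esub> v"
      by (rule reachable_mk_symmetricI)
  qed
qed

lemma card_pverts_eq_if_digraph_iso:
  assumes "digraph_iso (with_proj G) (with_proj G')"
  shows "card (pverts G) = card (pverts G')"
proof -
  from assms obtain f where "pre_digraph.digraph_isomorphism (with_proj G) f"
    and "with_proj G' = app_iso f (with_proj G)" unfolding digraph_iso_def by blast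
  then have "inj_on (iso_verts f) (pverts G)" "pverts G' = iso_verts f ` pverts G"
    by (auto simp: pre_digraph.digraph_isomorphism_def dest!: arg_cong[of _ _ verts])
  then show ?thesis by (simp add: card_image)
qed

section \<open>Strong edge colorings around triangles\<close>

lemma edge_in_edges: "(u, v) \<in> parcs G \<Longrightarrow> {u, v} \<in> edges G"
  unfolding edges_def by blast

lemma strong_edge_coloringD:
  assumes "strong_edge_coloring G c" "(u, v) \<in> parcs G" "(u', v') \<in> parcs G" "{u, v} \<noteq> {u', v'}"
    and "u = u' \<or> (u, u') \<in> parcs G"
  shows "c {u, v} \<noteq> c {u', v'}"
proof -
  have "{u, v} \<inter> {u', v'} \<noteq> {} \<or> (\<exists>w \<in> {u, v}. \<exists>w' \<in> {u', v'}. (w, w') \<in> parcs G)"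
    using assms(5) by auto
  then show ?thesis
    using bspec[OF bspec[OF assms(1)[unfolded strong_edge_coloring_def]
          edge_in_edges[OF assms(2)]] edge_in_edges[OF assms(3)]] assms(4)
    by (simp only: not_False_eq_True simp_thms)
qed

text \<open>
  Each edge leaving a triangle is joined by a triangle edge to the other two, and meets or is joined to
  every edge of the triangle. With six colours available this uses up all of them.
\<close>

lemma (in pair_graph) strong_edge_coloring_triangle:
  assumes c: "strong_edge_coloring G c"
    and "{(x, y), (x, z), (y, z), (x, x'), (y, y'), (z, z')} \<subseteq> parcs G"
    and "distinct [x, y, z, x', y', z']"
  shows "distinct [c {y, z}, c {x, z}, c {x, y}, c {x, x'}, c {y, y'}, c {z, z'}]"
proof -
  have "{(x, y), (x, z), (y, z), (x, x'), (y, y'), (z, z'), (y, x), (z, x), (z, y)} \<subseteq> parcs G"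
    using assms(2) arcs_symmetric by auto
  \<comment> \<open>The reversed list provides each inequality in the other orientation as well.\<close>
  moreover have "distinct (rev [x, y, z, x', y', z'])" using assms(3) by (simp only: distinct_rev)
  ultimately show ?thesis
    using assms(3) strong_edge_coloringD[OF c, of y z x z]
     strong_edge_coloringD[OF c, of y z x y]
     strong_edge_coloringD[OF c, of y z x x']
     strong_edge_coloringD[OF c, of y z y y']
     strong_edge_coloringD[OF c, of z y z z']
     strong_edge_coloringD[OF c, of x z x y]
     strong_edge_coloringD[OF c, of x z x x']
     strong_edge_coloringD[OF c, of x z y y']
     strong_edge_coloringD[OF c, of z x z z']
     strong_edge_coloringD[OF c, of x y x x']
     strong_edge_coloringD[OF c, of y x y y']
     strong_edge_coloringD[OF c, of x y z z']
     strong_edge_coloringD[OF c, of x x' y y']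
     strong_edge_coloringD[OF c, of x x' z z']
     strong_edge_coloringD[OF c, of y y' z z']
    by (simp add: doubleton_eq_iff insert_commute)
qed

text \<open>
  The edge \<open>x x'\<close> joins every edge at \<open>x\<close> to every edge at \<open>x'\<close>; this is how the choices made at one
  triangle restrict those at the next.
\<close>

lemma strong_edge_coloring_linked:
  assumes c: "strong_edge_coloring G c"
    and "{(x, y), (x, z), (x, x'), (x', y'), (x', z')} \<subseteq> parcs G"
    and "distinct [x, y, z, x', y', z']"
  shows "{c {x, y}, c {x, z}} \<inter> {c {x', y'}, c {x', z'}} = {}"
proof -
  have "c {x, a} \<noteq> c {x', b}" if "a \<in> {y, z}" "b \<in> {y', z'}" for a b
  proof (rule strong_edge_coloringD[OF c])
    show "(x, a) \<in> parcs G" "(x', b) \<in> parcs G" "x = x' \<or> (x, x') \<in> parcs G"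
      using assms(2) that by auto
    show "{x, a} \<noteq> {x', b}" using assms(3) that by (auto simp: doubleton_eq_iff)
  qed
  then show ?thesis by blast
qed

section \<open>A block needs seven colours\<close>

text \<open>
  The colours of the block: \<open>xy\<close>, \<open>xz\<close>, \<open>yz\<close>, \<open>r\<close> on the triangle \<open>x y z\<close> and the edge leaving \<open>x\<close>;
  \<open>s\<close>, \<open>t\<close> on \<open>y p\<close> and \<open>z q\<close>; \<open>m1\<close>, \<open>m2\<close> on the links \<open>p\<^sub>1 q\<^sub>1\<close> and \<open>p\<^sub>2 q\<^sub>2\<close>; \<open>a0\<close>, \<open>a1\<close>, \<open>a2\<close> on
  \<open>p\<^sub>1 p\<^sub>2\<close>, \<open>p p\<^sub>1\<close>, \<open>p p\<^sub>2\<close>, and likewise \<open>b0\<close>, \<open>b1\<close>, \<open>b2\<close> for \<open>q\<close>. The lists say that each triangle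
  and the edges leaving it are rainbow, the disjointness conditions that colours do not repeat
  between triangle edges at the two ends of a link.
\<close>

lemma no_six_colour_pattern:
  assumes P: "finite P" "card P \<le> 6"
    and T: "{xy, xz, yz, r, s, t} \<subseteq> P" "distinct [xy, xz, yz, r, s, t]"
    and A: "{a0, a1, a2, s, m1, m2} \<subseteq> P" "distinct [a0, a1, a2, s, m1, m2]"
    and B: "{b0, b1, b2, t, m1, m2} \<subseteq> P" "distinct [b0, b1, b2, t, m1, m2]"
    and TA: "{xy, yz} \<inter> {a1, a2} = {}" and TB: "{xz, yz} \<inter> {b1, b2} = {}"
    and AB1: "{a0, a1} \<inter> {b0, b1} = {}" and AB2: "{a0, a2} \<inter> {b0, b2} = {}"
  shows False
proof -
  have all_colours: "P = set cs" if "set cs \<subseteq> P" "distinct cs" "length cs = 6" for cs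
    using that P by (metis card_seteq distinct_card)
  have PT: "P = {xy, xz, yz, r, s, t}" using all_colours[of "[xy, xz, yz, r, s, t]"] T by simp
  have PA: "P = {a0, a1, a2, s, m1, m2}" using all_colours[of "[a0, a1, a2, s, m1, m2]"] A by simp
  have PB: "P = {b0, b1, b2, t, m1, m2}" using all_colours[of "[b0, b1, b2, t, m1, m2]"] B by simp
  have "P - {m1, m2} = {a0, a1, a2, s}" using PA A(2) by auto
  moreover have "P - {m1, m2} = {b0, b1, b2, t}" using PB B(2) by auto
  ultimately have shared: "{a0, a1, a2, s} = {b0, b1, b2, t}" by simp
  \<comment> \<open>A colour on the edge joining the two links could reappear in the other triangle only on an
    edge that meets a link, hence next to it.\<close>
  have "a0 = t" using shared AB1 AB2 by blast
  have "b0 = s" using shared AB1 AB2 by blast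
  have "{a0, a1, a2, s} - {s, t} = {a1, a2}" using A(2) \<open>a0 = t\<close> by auto
  moreover have "{b0, b1, b2, t} - {s, t} = {b1, b2}" using B(2) \<open>b0 = s\<close> by auto
  ultimately have outer: "{a1, a2} = {b1, b2}" using shared by simp
  have "{a1, a2} \<subseteq> {xy, xz, yz, r, s, t} - {xy, yz, s}" using A TA PT by auto
  moreover have "{b1, b2} \<subseteq> {xy, xz, yz, r, s, t} - {xz, yz, t}" using B TB PT by auto
  ultimately have "{a1, a2} \<subseteq> {r}" using outer by blast
  with A(2) show False by auto
qed

lemma (in pair_graph) seven_colours_if_block:
  assumes c: "strong_edge_coloring G c"
    and triangles: "{(x, y), (x, z), (y, z), (p, p1), (p, p2), (p1, p2), (q, q1), (q, q2), (q1, q2)}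
        \<subseteq> parcs G"
    and links: "{(x, r), (y, p), (z, q), (p1, q1), (p2, q2)} \<subseteq> parcs G"
    and dist: "distinct [r, x, y, z, p, p1, p2, q, q1, q2]"
  shows "7 \<le> card (c ` edges G)"
proof (rule ccontr)
  assume "\<not> 7 \<le> card (c ` edges G)"
  then have "card (c ` edges G) \<le> 6" by simp
  have "edges G = (\<lambda>(u, v). {u, v}) ` parcs G" unfolding edges_def by auto
  then have "finite (c ` edges G)" using pair_finite_arcs by simp
  note arcs = triangles links
  have rev: "{(y, x), (z, x), (z, y), (p1, p), (p2, p), (p2, p1), (q1, q), (q2, q), (q2, q1),
      (p, y), (q, z), (q1, p1), (q2, p2)} \<subseteq> parcs G"
    using arcs arcs_symmetric by auto
  show False
  proof (rule no_six_colour_pattern)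
    show "{c {x, y}, c {x, z}, c {y, z}, c {x, r}, c {y, p}, c {z, q}} \<subseteq> c ` edges G"
      "{c {p1, p2}, c {p, p1}, c {p, p2}, c {y, p}, c {p1, q1}, c {p2, q2}} \<subseteq> c ` edges G"
      "{c {q1, q2}, c {q, q1}, c {q, q2}, c {z, q}, c {p1, q1}, c {p2, q2}} \<subseteq> c ` edges G"
      using arcs edge_in_edges[of _ _ G] by auto
    have "distinct [c {y, z}, c {x, z}, c {x, y}, c {x, r}, c {y, p}, c {z, q}]"
      by (rule strong_edge_coloring_triangle[OF c]) (use arcs rev dist in auto)
    then show "distinct [c {x, y}, c {x, z}, c {y, z}, c {x, r}, c {y, p}, c {z, q}]"
      by (auto simp: insert_commute)
    have "distinct [c {p1, p2}, c {p, p2}, c {p, p1}, c {p, y}, c {p1, q1}, c {p2, q2}]"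
      by (rule strong_edge_coloring_triangle[OF c]) (use arcs rev dist in auto)
    then show "distinct [c {p1, p2}, c {p, p1}, c {p, p2}, c {y, p}, c {p1, q1}, c {p2, q2}]"
      by (auto simp: insert_commute)
    have "distinct [c {q1, q2}, c {q, q2}, c {q, q1}, c {q, z}, c {q1, p1}, c {q2, p2}]"
      by (rule strong_edge_coloring_triangle[OF c]) (use arcs rev dist in auto)
    then show "distinct [c {q1, q2}, c {q, q1}, c {q, q2}, c {z, q}, c {p1, q1}, c {p2, q2}]"
      by (auto simp: insert_commute)
    have "{c {y, x}, c {y, z}} \<inter> {c {p, p1}, c {p, p2}} = {}"
      by (rule strong_edge_coloring_linked[OF c]) (use arcs rev dist in auto)
    then show "{c {x, y}, c {y, z}} \<inter> {c {p, p1}, c {p, p2}} = {}"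
      by (simp only: insert_commute)
    have "{c {z, x}, c {z, y}} \<inter> {c {q, q1}, c {q, q2}} = {}"
      by (rule strong_edge_coloring_linked[OF c]) (use arcs rev dist in auto)
    then show "{c {x, z}, c {y, z}} \<inter> {c {q, q1}, c {q, q2}} = {}"
      by (simp only: insert_commute)
    have "{c {p1, p2}, c {p1, p}} \<inter> {c {q1, q2}, c {q1, q}} = {}"
      by (rule strong_edge_coloring_linked[OF c]) (use arcs rev dist in auto)
    then show "{c {p1, p2}, c {p, p1}} \<inter> {c {q1, q2}, c {q, q1}} = {}"
      by (simp only: insert_commute)
    have "{c {p2, p1}, c {p2, p}} \<inter> {c {q2, q1}, c {q2, q}} = {}"
      by (rule strong_edge_coloring_linked[OF c]) (use arcs rev dist in auto)
    then show "{c {p1, p2}, c {p, p2}} \<inter> {c {q1, q2}, c {q, q2}} = {}"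
      by (simp only: insert_commute)
  qed fact+
qed

section \<open>Two blocks joined by a bridge\<close>

text \<open>
  The vertices \<open>x, y, z\<close>, \<open>p, p\<^sub>1, p\<^sub>2\<close>, \<open>q, q\<^sub>1, q\<^sub>2\<close> of the block are numbered in this order, so that the
  triangles are the classes of vertices with equal quotient by 3.
\<close>

definition block :: "(nat \<times> nat) list" where
  "block = [(0,1),(0,2),(1,2), (3,4),(3,5),(4,5), (6,7),(6,8),(7,8), (1,3),(2,6),(4,7),(5,8)]"

definition double_block_edges :: "(nat \<times> nat) list" where
  "double_block_edges = (0, 9) # block @ map (\<lambda>(u, v). (u + 9, v + 9)) block"

definition double_block_arcs :: "(nat \<times> nat) list" where
  "double_block_arcs = double_block_edges @ map prod.swap double_block_edges"

definition double_block :: "nat pair_pre_digraph" where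
  "double_block = \<lparr> pverts = {..<18}, parcs = set double_block_arcs \<rparr>"

lemma pverts_double_block: "pverts double_block = set [0..<18]"
  and parcs_double_block: "parcs double_block = set double_block_arcs"
  by (auto simp: double_block_def)

lemma pair_graph_double_block: "pair_graph double_block"
proof
  have "\<forall>(u, v) \<in> set double_block_arcs. u \<in> set [0..<18] \<and> v \<in> set [0..<18] \<and> u \<noteq> v"
    by code_simp
  then show "fst e \<in> pverts double_block" "snd e \<in> pverts double_block" "fst e \<noteq> snd e"
    if "e \<in> parcs double_block" for e
    using that unfolding pverts_double_block parcs_double_block by auto
  show "symmetric (with_proj double_block)"
    by (auto simp: symmetric_def parcs_double_block double_block_arcs_def intro: symI)
qed (simp_all add: pverts_double_block parcs_double_block)

lemma cubic_double_block: "cubic double_block"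
  unfolding cubic_def
proof
  fix v assume "v \<in> pverts double_block"
  have "\<forall>v \<in> set [0..<18]. length (filter (\<lambda>e. fst e = v) double_block_arcs) = 3" by code_simp
  moreover have "distinct double_block_arcs" by code_simp
  moreover have "out_arcs (with_proj double_block) v = set (filter (\<lambda>e. fst e = v) double_block_arcs)"
    by (auto simp: out_arcs_def parcs_double_block)
  ultimately show "out_degree (with_proj double_block) v = 3"
    using \<open>v \<in> pverts double_block\<close>
    unfolding out_degree_def pverts_double_block by (metis distinct_card distinct_filter)
qed

lemma connected_double_block: "connected (with_proj double_block)"
proof (rule pair_graph.connected_if_smaller_neighbours[OF pair_graph_double_block])
  show "0 \<in> pverts double_block" by (simp add: pverts_double_block)
  have "\<forall>v \<in> set [0..<18]. v \<noteq> 0 \<longrightarrow> (\<exists>(w, u) \<in> set double_block_arcs. w = v \<and> u < v)" by code_simp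
  then show "\<exists>u. (v, u) \<in> parcs double_block \<and> id u < id v"
    if "v \<in> pverts double_block" "v \<noteq> 0" for v
    using that unfolding pverts_double_block parcs_double_block by fastforce
qed

lemma claw_free_double_block: "claw_free double_block"
proof (rule pair_graph.claw_free_if_cubic_if_vertices_in_triangles[OF pair_graph_double_block
      cubic_double_block])
  have "\<forall>v \<in> set [0..<18]. \<exists>(a, b) \<in> set double_block_arcs.
      (v, a) \<in> set double_block_arcs \<and> (v, b) \<in> set double_block_arcs"
    by code_simp
  then show "\<exists>a b. (v, a) \<in> parcs double_block \<and> (v, b) \<in> parcs double_block \<and> (a, b) \<in> parcs double_block"
    if "v \<in> pverts double_block" for v
    using that unfolding pverts_double_block parcs_double_block by fast
qed

lemma diamond_free_double_block: "diamond_free double_block"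
proof (rule diamond_free_if_unique_common_neighbour)
  \<comment> \<open>The only triangles are \<open>3 k, 3 k + 1, 3 k + 2\<close>, with vertex sum \<open>9 k + 3\<close>; so two vertices of
    a triangle determine the third.\<close>
  have "\<forall>(w, w') \<in> set double_block_arcs. \<forall>(a, u) \<in> set double_block_arcs.
      a = w \<longrightarrow> (w', u) \<in> set double_block_arcs \<longrightarrow> w + w' + u = 9 * (w div 3) + 3"
    by code_simp
  then have third: "w + w' + u = 9 * (w div 3) + 3"
    if "(w, w') \<in> parcs double_block" "(w, u) \<in> parcs double_block" "(w', u) \<in> parcs double_block"
    for w w' u
    using that unfolding parcs_double_block by fast
  show "u = v" if "(w, w') \<in> parcs double_block"
    "{(w, u), (w', u), (w, v), (w', v)} \<subseteq> parcs double_block" for u v w w'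
    using third[of w w' u] third[of w w' v] that by simp
qed

lemma seven_colours_double_block:
  assumes "strong_edge_coloring double_block c"
  shows "7 \<le> card (c ` edges double_block)"
  by (rule pair_graph.seven_colours_if_block[OF pair_graph_double_block assms,
        of 0 1 2 3 4 5 6 7 8 9])
    (simp_all add: parcs_double_block double_block_arcs_def double_block_edges_def block_def)

text \<open>
  Seven colours suffice: label the vertices so that the sum modulo 7 of the labels of the endpoints of
  an edge can serve as its colour. A colouring of this form is determined by only 18 numbers, and its
  value on \<open>{u, v}\<close> does not depend on how the edge is oriented.
\<close>

definition vertex_labels :: "nat list" where
  "vertex_labels = [0,1,3, 5,0,4, 2,0,6, 0,2,6, 3,0,1, 4,0,5]"

definition label_sum_coloring :: "nat set \<Rightarrow> nat" where
  "label_sum_coloring e = (\<Sum>v\<in>e. vertex_labels ! v) mod 7"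

lemma strong_edge_coloring_label_sum: "strong_edge_coloring double_block label_sum_coloring"
  unfolding strong_edge_coloring_def
proof (intro ballI impI)
  interpret pair_graph double_block by (rule pair_graph_double_block)
  fix e f assume "e \<in> edges double_block" "f \<in> edges double_block"
    and near: "e \<noteq> f \<and> (e \<inter> f \<noteq> {} \<or> (\<exists>u\<in>e. \<exists>v\<in>f. (u, v) \<in> parcs double_block))"
  then obtain u a where "u \<in> e" "a \<in> f" and ua: "u = a \<or> (u, a) \<in> parcs double_block" by blast
  have orient: "\<exists>v. e = {u, v} \<and> (u, v) \<in> parcs double_block"
    if "e \<in> edges double_block" "u \<in> e" for e u
    using that arcs_symmetric unfolding edges_def by (auto simp: insert_commute)
  obtain v b where e: "e = {u, v}" "(u, v) \<in> parcs double_block"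
    and f: "f = {a, b}" "(a, b) \<in> parcs double_block"
    using orient[OF \<open>e \<in> edges double_block\<close> \<open>u \<in> e\<close>] orient[OF \<open>f \<in> edges double_block\<close> \<open>a \<in> f\<close>]
    by blast
  have "\<forall>(u, v) \<in> set double_block_arcs. \<forall>(a, b) \<in> set double_block_arcs.
      u = a \<or> (u, a) \<in> set double_block_arcs \<longrightarrow>
      \<not> (u = a \<and> v = b \<or> u = b \<and> v = a) \<longrightarrow>
      (vertex_labels ! u + vertex_labels ! v) mod 7 \<noteq> (vertex_labels ! a + vertex_labels ! b) mod 7"
    by code_simp
  moreover have "\<not> (u = a \<and> v = b \<or> u = b \<and> v = a)"
    using near e f by (auto simp: doubleton_eq_iff)
  ultimately have "(vertex_labels ! u + vertex_labels ! v) mod 7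
      \<noteq> (vertex_labels ! a + vertex_labels ! b) mod 7"
    using ua e(2) f(2) unfolding parcs_double_block by fast
  moreover have "u \<noteq> v" "a \<noteq> b" using e(2) f(2) pair_no_loops by fastforce+
  ultimately show "label_sum_coloring e \<noteq> label_sum_coloring f"
    using e(1) f(1) by (simp add: label_sum_coloring_def)
qed

lemma strong_chromatic_index_double_block: "strong_chromatic_index double_block = 7"
  unfolding strong_chromatic_index_def
proof (rule Least_equality)
  have "card (label_sum_coloring ` edges double_block) \<le> card {..<7 :: nat}"
    by (rule card_mono) (auto simp: label_sum_coloring_def)
  with seven_colours_double_block[OF strong_edge_coloring_label_sum] strong_edge_coloring_label_sum
  show "\<exists>c. strong_edge_coloring double_block c \<and> card (c ` edges double_block) = 7"
    by (intro exI[of _ label_sum_coloring]) simp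
qed (use seven_colours_double_block in blast)

theorem theorem1:
  shows "\<exists>H :: nat pair_pre_digraph.
    pair_graph H \<and> connected (with_proj H) \<and> cubic H \<and> claw_free H \<and> diamond_free H \<and>
    card (pverts H) = 18 \<and>
    \<not> digraph_iso (with_proj H) (with_proj triangular_prism) \<and>
    strong_chromatic_index H = 7"
proof (intro exI[of _ double_block] conjI)
  show card: "card (pverts double_block) = 18" by (simp add: double_block_def)
  have "card (pverts triangular_prism) = 6"
    by (simp add: triangular_prism_def cartesian_product_def cycle_graph_def complete_graph_def)
  with card show "\<not> digraph_iso (with_proj double_block) (with_proj triangular_prism)"
    using card_pverts_eq_if_digraph_iso by fastforce
qed (fact pair_graph_double_block connected_double_block cubic_double_block claw_free_double_block
      diamond_free_double_block strong_chromatic_index_double_block)+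

end
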